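(* For every $d,m\in\mathbb{N}$ we have $w_e(dm)\ge(m-3)\,w_e(d)$. In particular, \[\limsup_{d\to\infty}\frac{w_e(d)}{d}=\sup_{d\in\mathbb{N}}\frac{w_e(d)}{d}\ge1.\]
   Context: A lattice $d$-simplex in $\mathbb{R}^d$ (vertices in $\mathbb{Z}^d$) is empty if its only points of $\mathbb{Z}^d$ are its vertices. The lattice width of a convex body $K\subset\mathbb{R}^d$ is $\inf_{f\in(\mathbb{Z}^d)^*\setminus\{0\}}(\max_K f-\min_K f)$. $w_e(d)$ denotes the maximum lattice width among empty $d$-simplices. *)

theory Defs
  imports "HOL-Analysis.Analysis" "HOL-Analysis.Finite_Function_Topology"
begin

text \<open>
  Since the dimension \<open>d\<close> varies inside the statement, \<open>\<real>\<^sup>d\<close> is modelled as the subspace of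
  the finitely supported functions of type \<open>nat \<Rightarrow>\<^sub>0 real\<close> whose support lies in \<open>{..<d}\<close>.
  This type is a real vector space, so the library's convex hulls and affine dependence apply.
\<close>

definition int_lattice :: "nat \<Rightarrow> (nat \<Rightarrow>\<^sub>0 real) set" where
  "int_lattice d = {x. Poly_Mapping.keys x \<subseteq> {..<d} \<and> (\<forall>i. Poly_Mapping.lookup x i \<in> \<int>)}"

text \<open>
  An element of the dual lattice of \<open>\<int>\<^sup>d\<close> is a linear functional on \<open>\<real>\<^sup>d\<close> taking integer values on
  \<open>\<int>\<^sup>d\<close>.  It is represented by its linear extensions to the whole type; all of them agree
  on \<open>\<real>\<^sup>d\<close>, and it is nonzero iff it does not vanish on \<open>\<int>\<^sup>d\<close>.
\<close>

definition nonzero_dual_lattice :: "nat \<Rightarrow> ((nat \<Rightarrow>\<^sub>0 real) \<Rightarrow> real) set" where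
  "nonzero_dual_lattice d =
     {f. linear f \<and> f ` int_lattice d \<subseteq> \<int> \<and> (\<exists>x\<in>int_lattice d. f x \<noteq> 0)}"

text \<open>
  For a convex body \<open>K\<close> the supremum and infimum of \<open>f\<close> over \<open>K\<close> are its maximum and minimum.
  The outer infimum is over a nonempty set only for \<open>d \<ge> 1\<close>.
\<close>

definition lattice_width :: "nat \<Rightarrow> (nat \<Rightarrow>\<^sub>0 real) set \<Rightarrow> real" where
  "lattice_width d K =
     (INF f\<in>nonzero_dual_lattice d. (SUP x\<in>K. f x) - (INF x\<in>K. f x))"

definition empty_simplex :: "nat \<Rightarrow> (nat \<Rightarrow>\<^sub>0 real) set \<Rightarrow> bool" where
  "empty_simplex d S \<longleftrightarrow>
     (\<exists>C. \<not> affine_dependent C \<and> card C = d + 1 \<and> C \<subseteq> int_lattice d \<and>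
          S = convex hull C \<and> S \<inter> int_lattice d = C)"

text \<open>
  For \<open>d \<ge> 1\<close> the widths of empty \<open>d\<close>-simplices are integers and, by the flatness theorem,
  bounded, so the supremum is the maximum.  It is taken in the extended reals so that the
  definition does not presuppose the flatness theorem.
\<close>

definition w_e :: "nat \<Rightarrow> ereal" where
  "w_e d = (SUP S\<in>{S. empty_simplex d S}. ereal (lattice_width d S))"

end

theory Submission
  imports Defs
begin

text \<open>
  Let \<open>S\<close> be an empty \<open>d\<close>-simplex with vertices \<open>v\<close> and \<open>v + w\<close>, \<open>w \<in> D\<close>, let \<open>m \<ge> 4\<close> and \<open>k = m - 2\<close>.
  Write \<open>\<real>\<^sup>d\<^sup>m\<close> as a cyclic sequence of \<open>m\<close> copies of \<open>\<real>\<^sup>d\<close> and take the simplex \<open>T\<close> with vertex \<open>0\<close>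
  and, for each \<open>w \<in> D\<close> and each \<open>i\<close>, the vertex with entry \<open>w\<close> in block \<open>i\<close> and \<open>k w\<close> in the next.

  \<open>T\<close> is empty: the total weight that a point of \<open>T\<close> puts on its \<open>m\<close> blocks is at most \<open>k + 1 < m\<close>,
  so some block receives weight less than \<open>1\<close>.  At a lattice point the emptiness of \<open>S\<close> makes this
  block zero, and then going once around the cycle each block is \<open>0\<close> or else the point is a vertex.

  \<open>T\<close> is wide: if \<open>f\<close> has components \<open>f\<^sub>i\<close> on the blocks, then its width on \<open>T\<close> is at least the width of
  \<open>f\<^sub>i + k f\<^sub>j\<close> on \<open>S\<close>, where \<open>j\<close> follows \<open>i\<close>.  Choosing \<open>f\<^sub>j\<close> of maximal width
  bounds this below by \<open>(k - 1)\<close> times the width of \<open>f\<^sub>j\<close>, hence by \<open>(m - 3)\<close> times the width of \<open>S\<close>.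
  The limit superior is bounded below along the multiples of a fixed \<open>d\<close>.
\<close>

section \<open>The integer lattice in coordinates\<close>

lemma int_latticeI:
  assumes "\<And>n. n \<ge> d \<Longrightarrow> Poly_Mapping.lookup x n = 0" "\<And>n. Poly_Mapping.lookup x n \<in> \<int>"
  shows "x \<in> int_lattice d"
  using assms not_le unfolding int_lattice_def by (auto simp: in_keys_iff)

lemma int_latticeD:
  assumes "x \<in> int_lattice d"
  shows "n \<ge> d \<Longrightarrow> Poly_Mapping.lookup x n = 0" "Poly_Mapping.lookup x n \<in> \<int>"
  using assms unfolding int_lattice_def by (auto simp: in_keys_iff subset_iff)

lemma lookup_scaleR [simp]:
  fixes x :: "'a \<Rightarrow>\<^sub>0 'b::real_vector"
  shows "Poly_Mapping.lookup (c *\<^sub>R x) i = c *\<^sub>R Poly_Mapping.lookup x i"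
proof -
  have "finite {i. c *\<^sub>R Poly_Mapping.lookup x i \<noteq> 0}"
    by (rule finite_subset[OF _ finite_keys[of x]]) (auto simp: in_keys_iff)
  then show ?thesis
    by (simp add: scaleR_poly_mapping_def)
qed

lemma int_lattice_0 [simp]: "0 \<in> int_lattice d"
  by (rule int_latticeI) auto

lemma int_lattice_add: "x \<in> int_lattice d \<Longrightarrow> y \<in> int_lattice d \<Longrightarrow> x + y \<in> int_lattice d"
  by (rule int_latticeI) (auto simp: lookup_add int_latticeD)

lemma int_lattice_diff: "x \<in> int_lattice d \<Longrightarrow> y \<in> int_lattice d \<Longrightarrow> x - y \<in> int_lattice d"
  by (rule int_latticeI) (auto simp: lookup_minus int_latticeD)

lemma int_lattice_scaleR_nat: "x \<in> int_lattice d \<Longrightarrow> real k *\<^sub>R x \<in> int_lattice d"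
  by (rule int_latticeI) (auto simp: int_latticeD)

lemma int_lattice_single: "i < d \<Longrightarrow> Poly_Mapping.single i 1 \<in> int_lattice d"
  by (rule int_latticeI) (auto simp: lookup_single when_def)

lemma int_lattice_expansion:
  assumes "x \<in> int_lattice d"
  shows "x = (\<Sum>i<d. Poly_Mapping.lookup x i *\<^sub>R Poly_Mapping.single i 1)"
proof (rule poly_mapping_eqI)
  fix n
  show "Poly_Mapping.lookup x n =
    Poly_Mapping.lookup (\<Sum>i<d. Poly_Mapping.lookup x i *\<^sub>R Poly_Mapping.single i 1) n"
    using int_latticeD(1)[OF assms, of n]
    by (cases "n < d") (auto simp: lookup_sum lookup_single when_def if_distrib cong: if_cong)
qed

section \<open>Width along one functional and lattice width\<close>

definition functional_width :: "('a::real_vector \<Rightarrow> real) \<Rightarrow> 'a set \<Rightarrow> real" where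
  "functional_width f K = (SUP x\<in>K. f x) - (INF x\<in>K. f x)"

text \<open>The image of the hull is the hull of finitely many reals, hence bounded; this is what
  makes the real-valued \<open>SUP\<close> and \<open>INF\<close> genuine bounds.\<close>

lemma functional_width_hull_ge:
  fixes f :: "'a::real_vector \<Rightarrow> real"
  assumes "finite C" "linear f" "x \<in> convex hull C" "y \<in> convex hull C"
  shows "f x - f y \<le> functional_width f (convex hull C)"
proof -
  have "bounded (f ` (convex hull C))"
    unfolding convex_hull_linear_image[OF assms(2)]
    using assms(1) by (simp add: bounded_convex_hull finite_imp_bounded)
  then have "f x \<le> (SUP x\<in>convex hull C. f x)" "(INF x\<in>convex hull C. f x) \<le> f y"
    using assms by (auto intro!: cSUP_upper cINF_lower bounded_imp_bdd_above bounded_imp_bdd_below)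
  then show ?thesis
    unfolding functional_width_def by linarith
qed

text \<open>A linear functional is extremal at vertices: the interval between its extreme values on
  \<open>C\<close> is convex, so it contains the image of the hull.\<close>

lemma functional_width_hull_attained:
  fixes f :: "'a::real_vector \<Rightarrow> real"
  assumes "finite C" "C \<noteq> {}" "linear f"
  obtains p q where "p \<in> C" "q \<in> C" "functional_width f (convex hull C) \<le> f p - f q"
proof -
  have "Max (f ` C) \<in> f ` C" "Min (f ` C) \<in> f ` C"
    using assms by (auto intro!: Max_in Min_in)
  then obtain p q where p: "p \<in> C" "f p = Max (f ` C)" and q: "q \<in> C" "f q = Min (f ` C)"
    by (metis imageE)
  have "f ` (convex hull C) \<subseteq> {f q..f p}"
    unfolding convex_hull_linear_image[OF assms(3)]
    by (rule hull_minimal) (use p q assms in auto)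
  then have "f x \<le> f p" "f q \<le> f x" if "x \<in> convex hull C" for x
    using that by auto
  then have "(SUP x\<in>convex hull C. f x) \<le> f p" "f q \<le> (INF x\<in>convex hull C. f x)"
    using assms by (auto intro!: cSUP_least cINF_greatest)
  then show thesis
    using that[OF p(1) q(1)] unfolding functional_width_def by linarith
qed

lemma empty_simplex_finite:
  assumes "empty_simplex d S"
  obtains C where "finite C" "C \<noteq> {}" "S = convex hull C"
proof -
  obtain C where C: "card C = d + 1" "S = convex hull C"
    using assms unfolding empty_simplex_def by blast
  have "finite C" "C \<noteq> {}"
    using C(1) by (auto intro: card_ge_0_finite)
  then show thesis
    using C(2) that by blast
qed

text \<open>A real infimum is a lower bound only if the family is bounded below. Here 0 is such a
  bound, since a simplex has a point.\<close>

lemma empty_simplex_width_le: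
  assumes "empty_simplex d S" "f \<in> nonzero_dual_lattice d"
  shows "lattice_width d S \<le> functional_width f S"
  unfolding lattice_width_def functional_width_def[symmetric]
proof (rule cINF_lower[OF bdd_belowI2 assms(2)])
  fix g assume "g \<in> nonzero_dual_lattice d"
  then have g: "linear g"
    by (simp add: nonzero_dual_lattice_def)
  obtain C where C: "finite C" "C \<noteq> {}" "S = convex hull C"
    using empty_simplex_finite[OF assms(1)] .
  then obtain c where "c \<in> convex hull C"
    by (metis all_not_in_conv convex_hull_eq_empty)
  then show "0 \<le> functional_width g S"
    using functional_width_hull_ge[OF C(1) g] C(3) by fastforce
qed

lemma nonzero_dual_lattice_nonempty:
  assumes "d \<ge> 1"
  shows "nonzero_dual_lattice d \<noteq> {}"
proof -
  have "linear (\<lambda>x::nat \<Rightarrow>\<^sub>0 real. Poly_Mapping.lookup x 0)"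
    by (rule linearI) (auto simp: lookup_add)
  moreover have "Poly_Mapping.single 0 1 \<in> int_lattice d"
    by (rule int_lattice_single) (use assms in simp)
  ultimately have "(\<lambda>x. Poly_Mapping.lookup x 0) \<in> nonzero_dual_lattice d"
    unfolding nonzero_dual_lattice_def by (auto intro: int_latticeD intro!: bexI[of _ "Poly_Mapping.single 0 1"])
  then show ?thesis by blast
qed

lemma lattice_width_ge:
  assumes "d \<ge> 1" "\<And>f. f \<in> nonzero_dual_lattice d \<Longrightarrow> w \<le> functional_width f K"
  shows "w \<le> lattice_width d K"
  unfolding lattice_width_def functional_width_def[symmetric]
  by (rule cINF_greatest) (use assms nonzero_dual_lattice_nonempty in auto)

section \<open>Empty simplices in terms of coefficients\<close>

text \<open>With one vertex at the origin, the points of the hull are the combinations of the others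
  with nonnegative coefficients of sum at most 1. Emptiness thus becomes a condition on
  coefficients.\<close>

lemma empty_simplexI:
  fixes e :: "'i \<Rightarrow> (nat \<Rightarrow>\<^sub>0 real)"
  assumes fin: "finite J" and card: "card J = d"
    and lat: "\<And>j. j \<in> J \<Longrightarrow> e j \<in> int_lattice d"
    and indep: "\<And>l j. (\<Sum>j\<in>J. l j *\<^sub>R e j) = 0 \<Longrightarrow> j \<in> J \<Longrightarrow> l j = 0"
    and empty: "\<And>l. (\<And>j. j \<in> J \<Longrightarrow> 0 \<le> l j) \<Longrightarrow> sum l J \<le> 1 \<Longrightarrow>
      (\<Sum>j\<in>J. l j *\<^sub>R e j) \<in> int_lattice d \<Longrightarrow> (\<forall>j\<in>J. l j = 0) \<or> (\<exists>j\<in>J. l j = 1)"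
  shows "empty_simplex d (convex hull (insert 0 (e ` J)))"
  unfolding empty_simplex_def
proof (intro exI conjI)
  have inj: "inj_on e J"
  proof (rule inj_onI, rule ccontr)
    fix i j assume ij: "i \<in> J" "j \<in> J" "e i = e j" "i \<noteq> j"
    \<comment> \<open>The coefficients of the relation \<open>e i - e j = 0\<close>, which
      independence forbids.\<close>
    let ?l = "\<lambda>n. of_bool (n = i) - of_bool (n = j) :: real"
    have "(\<Sum>n\<in>J. ?l n *\<^sub>R e n) = e i - e j"
      using fin ij by (simp add: scaleR_diff_left sum_subtractf of_bool_def if_distrib[of "\<lambda>c. c *\<^sub>R _"] cong: if_cong)
    then have "?l i = 0"
      using indep[of ?l i] ij by auto
    then show False using ij by auto
  qed
  have ind: "independent (e ` J)"
  proof (rule real_vector.independent_if_scalars_zero)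
    show "finite (e ` J)" using fin by simp
    fix f x assume "(\<Sum>x\<in>e ` J. f x *\<^sub>R x) = 0" and x: "x \<in> e ` J"
    then have "(\<Sum>j\<in>J. f (e j) *\<^sub>R e j) = 0"
      by (simp add: sum.reindex[OF inj])
    from indep[OF this] x show "f x = 0" by auto
  qed
  then have zero: "0 \<notin> e ` J"
    using real_vector.dependent_zero by blast
  show "\<not> affine_dependent (insert 0 (e ` J))"
    using affine_dependent_iff_dependent[OF zero] ind by simp
  show "card (insert 0 (e ` J)) = d + 1"
    using zero fin card card_image[OF inj] by simp
  show lat0: "insert 0 (e ` J) \<subseteq> int_lattice d"
    using lat by auto
  show "convex hull (insert 0 (e ` J)) \<inter> int_lattice d = insert 0 (e ` J)"
  proof
    show "insert 0 (e ` J) \<subseteq> convex hull (insert 0 (e ` J)) \<inter> int_lattice d"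
      using lat0 hull_subset[of _ convex] by (intro Int_greatest)
    show "convex hull (insert 0 (e ` J)) \<inter> int_lattice d \<subseteq> insert 0 (e ` J)"
    proof safe
      fix x assume x: "x \<in> convex hull (insert 0 (e ` J))" "x \<in> int_lattice d" "x \<notin> e ` J"
      have "finite (insert 0 (e ` J))" using fin by simp
      then obtain u where u: "\<forall>y\<in>insert 0 (e ` J). 0 \<le> u y" "sum u (insert 0 (e ` J)) = 1"
        "(\<Sum>y\<in>insert 0 (e ` J). u y *\<^sub>R y) = x"
        using x(1) by (auto simp: convex_hull_finite)
      define l where "l = (\<lambda>j. u (e j))"
      have l0: "\<And>j. j \<in> J \<Longrightarrow> 0 \<le> l j"
        using u(1) by (simp add: l_def)
      have l1: "sum l J \<le> 1"
        using u(1,2) fin zero by (simp add: l_def sum.reindex[OF inj])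
      have lx: "(\<Sum>j\<in>J. l j *\<^sub>R e j) = x"
        using u(3) fin zero by (simp add: l_def sum.reindex[OF inj])
      consider "\<forall>j\<in>J. l j = 0" | j where "j \<in> J" "l j = 1"
        using empty[OF l0 l1] lx x(2) by blast
      then show "x = 0"
      proof cases
        case 1
        then show ?thesis using lx by simp
      next
        case 2
        \<comment> \<open>The coefficient 1 at \<open>j\<close> uses up the whole weight, so the
          others vanish.\<close>
        then have "sum l (J - {j}) \<le> 0"
          using l1 fin by (simp add: sum_diff1)
        then have "\<forall>i\<in>J - {j}. l i = 0"
          by (metis (no_types, lifting) DiffD1 antisym fin finite_Diff l0 sum_nonneg sum_nonneg_eq_0_iff)
        then have "x = e j"
          using lx fin 2 by (simp add: sum.remove[of J j])
        then show ?thesis using x(3) 2 by blast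
      qed
    qed
  qed
qed simp

text \<open>Subtracting a lattice point preserves the lattice, so any vertex \<open>v\<close> can be
  moved to the origin; \<open>D\<close> collects the edge vectors at \<open>v\<close>.\<close>

lemma empty_simplexE:
  assumes "empty_simplex d S"
  obtains v D where "v \<in> int_lattice d" "finite D" "card D = d" "D \<subseteq> int_lattice d"
    "independent D" "S = convex hull ((+) v ` insert 0 D)"
    "\<And>l. (\<And>w. w \<in> D \<Longrightarrow> 0 \<le> l w) \<Longrightarrow> sum l D \<le> 1 \<Longrightarrow>
      (\<Sum>w\<in>D. l w *\<^sub>R w) \<in> int_lattice d \<Longrightarrow> (\<forall>w\<in>D. l w = 0) \<or> (\<exists>w\<in>D. l w = 1)"
proof -
  obtain C where C: "\<not> affine_dependent C" "card C = d + 1" "C \<subseteq> int_lattice d"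
    "S = convex hull C" "S \<inter> int_lattice d = C"
    using assms unfolding empty_simplex_def by blast
  have finC: "finite C" and "C \<noteq> {}"
    using C(2) by (auto intro: card_ge_0_finite)
  then obtain v where v: "v \<in> C" by blast
  define D where "D = (\<lambda>x. - v + x) ` (C - {v})"
  have finD: "finite D" using finC by (simp add: D_def)
  have ind: "independent D"
    using affine_dependent_iff_dependent2[OF v] C(1) by (simp add: D_def)
  then have zero: "0 \<notin> D"
    using real_vector.dependent_zero by blast
  have "card D = card (C - {v})"
    unfolding D_def by (rule card_image) auto
  then have cD: "card D = d" using C(2) v finC by simp
  have latD: "D \<subseteq> int_lattice d"
    using C(3) v int_lattice_diff by (fastforce simp: D_def)
  have "(+) v ` D = C - {v}"
    by (simp add: D_def image_image)
  then have CD: "C = (+) v ` insert 0 D"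
    using v by auto
  show thesis
  proof (rule that[OF _ finD cD latD ind])
    show "v \<in> int_lattice d" using v C(3) by blast
    show "S = convex hull (+) v ` insert 0 D" using C(4) CD by simp
    fix l :: "_ \<Rightarrow> real"
    assume l0: "\<And>w. w \<in> D \<Longrightarrow> 0 \<le> l w" and l1: "sum l D \<le> 1"
      and lat: "(\<Sum>w\<in>D. l w *\<^sub>R w) \<in> int_lattice d"
    let ?x = "\<Sum>w\<in>D. l w *\<^sub>R w"
    have "?x \<in> convex hull (insert 0 D)"
    proof -
      \<comment> \<open>The origin takes the slack that completes the weights to sum 1.\<close>
      let ?u = "\<lambda>w. if w = 0 then 1 - sum l D else l w"
      have *: "sum ?u D = sum l D" "(\<Sum>w\<in>D. ?u w *\<^sub>R w) = ?x"
        using zero by (auto intro!: sum.cong)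
      have "\<forall>w\<in>insert 0 D. 0 \<le> ?u w" "sum ?u (insert 0 D) = 1"
        "(\<Sum>w\<in>insert 0 D. ?u w *\<^sub>R w) = ?x"
        using finD zero l0 l1 * by (auto simp: sum.insert)
      then show ?thesis
        using finD by (subst convex_hull_finite) (auto intro!: exI[of _ ?u])
    qed
    then have "v + ?x \<in> S"
      using C(4) CD convex_hull_translation[of v "insert 0 D"] by auto
    then have "v + ?x \<in> C"
      using lat v C(3,5) int_lattice_add by blast
    then consider "?x = 0" | w where "w \<in> D" "?x = w"
      unfolding CD by auto
    then show "(\<forall>w\<in>D. l w = 0) \<or> (\<exists>w\<in>D. l w = 1)"
    proof cases
      case 1
      then show ?thesis
        using ind finD real_vector.independentD[of D D l] by blast
    next
      case 2
      \<comment> \<open>Two representations of \<open>w\<close> are subtracted, so independence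
        forces \<open>l w = 1\<close>.\<close>
      have "(\<Sum>y\<in>D. (l y - of_bool (y = w)) *\<^sub>R y) = 0"
        using finD 2 by (simp add: scaleR_diff_left sum_subtractf of_bool_def if_distrib[of "\<lambda>c. c *\<^sub>R _"] cong: if_cong)
      then have "l w - of_bool (w = w) = 0"
        using real_vector.independentD[OF ind finD order_refl, of "\<lambda>y. l y - of_bool (y = w)"] 2 by blast
      then show ?thesis using 2 by auto
    qed
  qed
qed

section \<open>The standard simplex\<close>

text \<open>A nonzero integral functional is nonzero at some unit vector, hence at least 1 there in
  absolute value, while it is 0 at the vertex 0.\<close>

lemma w_e_ge_1:
  assumes "d \<ge> 1"
  shows "1 \<le> w_e d"
proof -
  let ?e = "\<lambda>i. Poly_Mapping.single i 1 :: nat \<Rightarrow>\<^sub>0 real"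
  let ?S = "convex hull (insert 0 (?e ` {..<d}))"
  have coord: "Poly_Mapping.lookup (\<Sum>i<d. l i *\<^sub>R ?e i) j = l j" if "j < d" for l j
    using that by (auto simp: lookup_sum lookup_single when_def if_distrib cong: if_cong)
  have S: "empty_simplex d ?S"
  proof (rule empty_simplexI)
    fix l :: "nat \<Rightarrow> real"
    assume l: "\<And>j. j \<in> {..<d} \<Longrightarrow> 0 \<le> l j" "sum l {..<d} \<le> 1"
      "(\<Sum>i<d. l i *\<^sub>R ?e i) \<in> int_lattice d"
    have "l j = 0 \<or> l j = 1" if "j < d" for j
    proof -
      have "l j \<in> \<int>"
        using int_latticeD(2)[OF l(3), of j] coord[OF that] by simp
      then obtain z where z: "l j = of_int z" by (auto elim: Ints_cases)
      have "l j \<le> sum l {..<d}"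
        using l(1) that by (intro member_le_sum) auto
      then have "0 \<le> z" "z \<le> 1" using z l that
        by (metis of_int_0_le_iff lessThan_iff, metis of_int_le_1_iff order_trans)
      then show ?thesis using z by (cases "z = 0") auto
    qed
    then show "(\<forall>j\<in>{..<d}. l j = 0) \<or> (\<exists>j\<in>{..<d}. l j = 1)" by blast
  next
    fix l :: "nat \<Rightarrow> real" and j
    assume "(\<Sum>i<d. l i *\<^sub>R ?e i) = 0" "j \<in> {..<d}"
    then show "l j = 0" using coord[of j l] by simp
  qed (auto intro: int_lattice_single)
  have "1 \<le> lattice_width d ?S"
  proof (rule lattice_width_ge[OF assms])
    fix f assume "f \<in> nonzero_dual_lattice d"
    then have f: "linear f" "f ` int_lattice d \<subseteq> \<int>" and "\<exists>x\<in>int_lattice d. f x \<noteq> 0"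
      by (auto simp: nonzero_dual_lattice_def)
    then obtain x where x: "x \<in> int_lattice d" "f x \<noteq> 0" by blast
    have "f x = (\<Sum>i<d. Poly_Mapping.lookup x i *\<^sub>R f (?e i))"
      by (subst int_lattice_expansion[OF x(1)])
        (simp add: linear_sum[OF f(1)] linear_cmul[OF f(1)])
    then obtain i where i: "i < d" "f (?e i) \<noteq> 0"
      using x(2) by (metis (no_types, lifting) lessThan_iff scaleR_eq_0_iff sum.neutral)
    have "f (?e i) \<in> \<int>"
      using f(2) int_lattice_single[OF i(1)] by blast
    then have "1 \<le> \<bar>f (?e i)\<bar>"
      using i(2) Ints_nonzero_abs_ge1 by blast
    moreover have "?e i \<in> ?S" "0 \<in> ?S"
      using i by (auto intro: hull_inc)
    then have "f (?e i) - f 0 \<le> functional_width f ?S" "f 0 - f (?e i) \<le> functional_width f ?S"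
      using f(1) by (auto intro!: functional_width_hull_ge)
    ultimately show "1 \<le> functional_width f ?S"
      using linear_0[OF f(1)] by linarith
  qed
  then show ?thesis
    unfolding w_e_def using S by (intro SUP_upper2[of ?S]) (auto simp: one_ereal_def)
qed


text \<open>Only differences of values enter the width, so the shift by \<open>v\<close>
  cancels.\<close>

lemma functional_width_hull_insert_translation:
  assumes "finite D" "linear f" "p \<in> insert 0 D" "q \<in> insert 0 D"
  shows "f p - f q \<le> functional_width f (convex hull ((+) v ` insert 0 D))"
proof -
  have "f (v + p) - f (v + q) \<le> functional_width f (convex hull ((+) v ` insert 0 D))"
    by (rule functional_width_hull_ge) (use assms in \<open>auto intro: hull_inc\<close>)
  then show ?thesis
    by (simp add: linear_add[OF assms(2)])
qed

section \<open>Splitting the large space into blocks\<close>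

text \<open>\<open>embed\<close> and \<open>block\<close> are inclusion and projection of the
  \<open>i\<close>-th summand in a direct sum of copies of \<open>\<real>\<^sup>d\<close>, with
  coordinates numbered block after block.\<close>

definition embed :: "nat \<Rightarrow> nat \<Rightarrow> (nat \<Rightarrow>\<^sub>0 real) \<Rightarrow> (nat \<Rightarrow>\<^sub>0 real)" where
  "embed d i x = Abs_poly_mapping (\<lambda>n. if n div d = i then Poly_Mapping.lookup x (n mod d) else 0)"

definition block :: "nat \<Rightarrow> nat \<Rightarrow> (nat \<Rightarrow>\<^sub>0 real) \<Rightarrow> (nat \<Rightarrow>\<^sub>0 real)" where
  "block d i x = Abs_poly_mapping (\<lambda>n. if n < d then Poly_Mapping.lookup x (i * d + n) else 0)"

lemma lookup_embed [simp]:
  "Poly_Mapping.lookup (embed d i x) n = (if n div d = i then Poly_Mapping.lookup x (n mod d) else 0)"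
proof -
  have "{n. (if n div d = i then Poly_Mapping.lookup x (n mod d) else 0) \<noteq> 0}
    \<subseteq> (\<lambda>n. i * d + n) ` Poly_Mapping.keys x"
  proof
    fix n assume "n \<in> {n. (if n div d = i then Poly_Mapping.lookup x (n mod d) else 0) \<noteq> 0}"
    then have "n div d = i" "n mod d \<in> Poly_Mapping.keys x"
      by (auto simp: in_keys_iff split: if_splits)
    then show "n \<in> (\<lambda>n. i * d + n) ` Poly_Mapping.keys x"
      by (metis div_mult_mod_eq imageI)
  qed
  then have "finite {n. (if n div d = i then Poly_Mapping.lookup x (n mod d) else 0) \<noteq> 0}"
    by (rule finite_subset) simp
  then show ?thesis
    by (simp add: embed_def)
qed

lemma lookup_block [simp]:
  "Poly_Mapping.lookup (block d i x) n = (if n < d then Poly_Mapping.lookup x (i * d + n) else 0)"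
proof -
  have "finite {n. (if n < d then Poly_Mapping.lookup x (i * d + n) else 0) \<noteq> 0}"
    by (rule finite_subset[of _ "{..<d}"]) auto
  then show ?thesis
    by (simp add: block_def)
qed

lemma linear_embed: "linear (embed d i)"
  by (rule linearI) (auto intro!: poly_mapping_eqI simp: lookup_add)

lemma linear_block: "linear (block d i)"
  by (rule linearI) (auto intro!: poly_mapping_eqI simp: lookup_add)

lemma block_embed:
  assumes "x \<in> int_lattice d"
  shows "block d j (embed d i x) = (if i = j then x else 0)"
  by (rule poly_mapping_eqI) (auto simp: int_latticeD(1)[OF assms])

lemma embed_int_lattice:
  assumes "x \<in> int_lattice d" "i < m"
  shows "embed d i x \<in> int_lattice (d * m)"
proof (rule int_latticeI)
  fix n assume n: "d * m \<le> n"
  show "Poly_Mapping.lookup (embed d i x) n = 0"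
  \<comment> \<open>For \<open>d = 0\<close>, \<open>n div d\<close> is 0 and says nothing about
    \<open>n\<close>, but then \<open>x\<close> is zero.\<close>
  proof (cases "d = 0")
    case True
    then show ?thesis using int_latticeD(1)[OF assms(1)] by auto
  next
    case False
    then have "m \<le> n div d"
      using n by (metis div_le_mono nonzero_mult_div_cancel_left)
    then show ?thesis using assms(2) by auto
  qed
qed (use int_latticeD(2)[OF assms(1)] in auto)

lemma block_int_lattice: "x \<in> int_lattice n \<Longrightarrow> block d i x \<in> int_lattice d"
  by (rule int_latticeI) (auto simp: int_latticeD)

lemma sum_embed_block:
  assumes "x \<in> int_lattice (d * m)" "d \<ge> 1"
  shows "(\<Sum>i<m. embed d i (block d i x)) = x"
proof (rule poly_mapping_eqI)
  fix n
  have "n mod d < d" "n div d * d + n mod d = n" using assms by auto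
  then have "Poly_Mapping.lookup (\<Sum>i<m. embed d i (block d i x)) n =
      (if n div d < m then Poly_Mapping.lookup x n else 0)"
    by (simp add: lookup_sum)
  moreover have "n \<ge> d * m" if "\<not> n div d < m"
    using that assms(2) by (metis Suc_le_lessD div_less_iff_less_mult mult.commute not_less One_nat_def)
  ultimately show "Poly_Mapping.lookup (\<Sum>i<m. embed d i (block d i x)) n = Poly_Mapping.lookup x n"
    using int_latticeD(1)[OF assms(1)] by auto
qed

section \<open>The cyclic order of the blocks\<close>

text \<open>Unlike \<open>Suc i mod m\<close>, this form is injective on all naturals and not only
  below \<open>m\<close>.\<close>

definition cyc_suc :: "nat \<Rightarrow> nat \<Rightarrow> nat" where
  "cyc_suc m i = (if Suc i = m then 0 else Suc i)"

lemma cyc_suc_less: "i < m \<Longrightarrow> cyc_suc m i < m"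
  by (auto simp: cyc_suc_def)

lemma cyc_suc_eq_iff: "cyc_suc m i = cyc_suc m j \<longleftrightarrow> i = j"
  by (auto simp: cyc_suc_def)

lemma cyc_suc_surj:
  assumes "j < m"
  obtains i where "i < m" "cyc_suc m i = j"
proof (cases j)
  case 0
  then show ?thesis using assms that[of "m - 1"] by (simp add: cyc_suc_def)
next
  case (Suc i)
  then show ?thesis using assms that[of i] by (simp add: cyc_suc_def)
qed

lemma sum_cyc_suc:
  fixes g :: "nat \<Rightarrow> 'a::comm_monoid_add"
  shows "(\<Sum>i<m. g (cyc_suc m i)) = sum g {..<m}"
  by (rule sum.reindex_bij_betw)
    (auto simp: bij_betw_def inj_on_def cyc_suc_eq_iff cyc_suc_less elim: cyc_suc_surj intro: imageI)

text \<open>Climb from \<open>i\<close> to \<open>m - 1\<close>, wrap around to 0, then climb to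
  \<open>j\<close>.\<close>

lemma cyc_suc_induct:
  assumes "i < m" "P i" "\<And>i. i < m \<Longrightarrow> P i \<Longrightarrow> P (cyc_suc m i)" "j < m"
  shows "P j"
proof -
  have step: "P (Suc n)" if "P n" "Suc n < m" for n
    using assms(3)[of n] that by (simp add: cyc_suc_def)
  have up: "j < m \<longrightarrow> P j" if "a \<le> j" "P a" for a j
    using that by (induction rule: dec_induct) (auto intro: step)
  have "P (m - 1)" using up[of i "m - 1"] assms(1,2) by simp
  then have "P 0"
    using assms(3)[of "m - 1"] assms(1) by (simp add: cyc_suc_def)
  then show ?thesis using up[of 0 j] assms(4) by simp
qed

section \<open>The large simplex\<close>

definition cyc_vertex :: "nat \<Rightarrow> nat \<Rightarrow> nat \<Rightarrow> nat \<times> (nat \<Rightarrow>\<^sub>0 real) \<Rightarrow> (nat \<Rightarrow>\<^sub>0 real)" where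
  "cyc_vertex d m k = (\<lambda>(i, w). embed d i w + real k *\<^sub>R embed d (cyc_suc m i) w)"

text \<open>Only two families of vertices reach this block: its own, with factor 1, and that of its
  predecessor \<open>i\<close>, with factor \<open>k\<close>.\<close>

lemma block_sum_cyc_vertex:
  assumes "i < m" "D \<subseteq> int_lattice d"
  shows "block d (cyc_suc m i) (\<Sum>p\<in>{..<m} \<times> D. l p *\<^sub>R cyc_vertex d m k p) =
    (\<Sum>w\<in>D. (l (cyc_suc m i, w) + real k * l (i, w)) *\<^sub>R w)"
proof -
  let ?b = "block d (cyc_suc m i)"
  \<comment> \<open>The two conditionals are added, not nested, which is right also when
    \<open>cyc_suc m i = i\<close>.\<close>
  have b: "?b (l (j, w) *\<^sub>R cyc_vertex d m k (j, w)) =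
      (if j = cyc_suc m i then l (j, w) *\<^sub>R w else 0) + (if j = i then (real k * l (j, w)) *\<^sub>R w else 0)"
    if "w \<in> D" for j w
    using that assms(2)
    by (auto simp: cyc_vertex_def linear_cmul[OF linear_block] linear_add[OF linear_block]
        block_embed[OF subsetD[OF assms(2)]] cyc_suc_eq_iff scaleR_add_right)
  have "?b (\<Sum>p\<in>{..<m} \<times> D. l p *\<^sub>R cyc_vertex d m k p) =
      (\<Sum>j<m. \<Sum>w\<in>D. ?b (l (j, w) *\<^sub>R cyc_vertex d m k (j, w)))"
    by (simp add: linear_sum[OF linear_block] sum.cartesian_product split_def)
  also have "\<dots> = (\<Sum>w\<in>D. \<Sum>j<m. ?b (l (j, w) *\<^sub>R cyc_vertex d m k (j, w)))"
    by (rule sum.swap)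
  also have "\<dots> = (\<Sum>w\<in>D. (l (cyc_suc m i, w) + real k * l (i, w)) *\<^sub>R w)"
    using assms(1) cyc_suc_less[OF assms(1)]
    by (intro sum.cong refl) (simp add: b sum.distrib scaleR_add_left)
  finally show ?thesis .
qed

text \<open>\<open>k + 1 < m\<close> gives emptiness; \<open>k > 1\<close> gives independence and a
  positive factor \<open>k - 1\<close>.\<close>

lemma ex_large_simplex:
  assumes "d \<ge> 1" "k \<ge> 2" "k + 1 < m" "empty_simplex d S"
  obtains T where "empty_simplex (d * m) T"
    "(real k - 1) * lattice_width d S \<le> lattice_width (d * m) T"
proof (rule empty_simplexE[OF assms(4)])
  fix v D
  assume "v \<in> int_lattice d" and D: "finite D" "card D = d" "D \<subseteq> int_lattice d"
    and indep: "independent D" and S: "S = convex hull ((+) v ` insert 0 D)"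
    and empty: "\<And>l. (\<And>w. w \<in> D \<Longrightarrow> 0 \<le> l w) \<Longrightarrow> sum l D \<le> 1 \<Longrightarrow>
      (\<Sum>w\<in>D. l w *\<^sub>R w) \<in> int_lattice d \<Longrightarrow> (\<forall>w\<in>D. l w = 0) \<or> (\<exists>w\<in>D. l w = 1)"
  let ?e = "cyc_vertex d m k" and ?J = "{..<m} \<times> D" and ?nx = "cyc_suc m"
  let ?T = "convex hull (insert 0 (?e ` ?J))"
  have finJ: "finite ?J" using D by simp
  have T: "empty_simplex (d * m) ?T"
  proof (rule empty_simplexI)
    show "finite ?J" by (rule finJ)
    show "card ?J = d * m" using D by (simp add: card_cartesian_product)
    show "?e j \<in> int_lattice (d * m)" if "j \<in> ?J" for j
      using that D(3)
      by (auto simp: cyc_vertex_def intro!: int_lattice_add int_lattice_scaleR_nat embed_int_lattice cyc_suc_less)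
  next
    fix l j assume l: "(\<Sum>j\<in>?J. l j *\<^sub>R ?e j) = 0" and j: "j \<in> ?J"
    \<comment> \<open>Each block of a vanishing combination is a relation on the independent set
      \<open>D\<close>. Summing absolute values around the cycle then gives
      \<open>s = k * s\<close>, so \<open>s = 0\<close>.\<close>
    have rec: "\<bar>l (?nx i, w)\<bar> = real k * \<bar>l (i, w)\<bar>" if "i < m" "w \<in> D" for i w
    proof -
      have "(\<Sum>w\<in>D. (l (?nx i, w) + real k * l (i, w)) *\<^sub>R w) = 0"
        using block_sum_cyc_vertex[OF that(1) D(3), of l k] l linear_0[OF linear_block] by simp
      then have "l (?nx i, w) + real k * l (i, w) = 0"
        using real_vector.independentD[OF indep D(1) order_refl, of "\<lambda>w. l (?nx i, w) + real k * l (i, w)"]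
          that(2) by blast
      then have "l (?nx i, w) = - (real k * l (i, w))" by simp
      then show ?thesis by (simp add: abs_mult)
    qed
    obtain i0 w where iw: "j = (i0, w)" "i0 < m" "w \<in> D" using j by auto
    have "(\<Sum>i<m. \<bar>l (i, w)\<bar>) = (\<Sum>i<m. \<bar>l (?nx i, w)\<bar>)"
      by (rule sum_cyc_suc[symmetric])
    also have "\<dots> = real k * (\<Sum>i<m. \<bar>l (i, w)\<bar>)"
      using rec[OF _ iw(3)] by (simp add: sum_distrib_left)
    finally have "(\<Sum>i<m. \<bar>l (i, w)\<bar>) = 0"
      using assms(2) by simp
    then show "l j = 0"
      using iw by (simp add: sum_nonneg_eq_0_iff)
  next
    fix l
    assume l0: "\<And>j. j \<in> ?J \<Longrightarrow> 0 \<le> l j" and l1: "sum l ?J \<le> 1"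
      and lat: "(\<Sum>j\<in>?J. l j *\<^sub>R ?e j) \<in> int_lattice (d * m)"
    define L where "L = (\<lambda>i. \<Sum>w\<in>D. l (i, w))"
    have L1: "sum L {..<m} \<le> 1"
      using l1 by (simp add: L_def sum.cartesian_product split_def)
    have L0: "0 \<le> L i" if "i < m" for i
      using l0 that by (auto simp: L_def intro!: sum_nonneg)
    \<comment> \<open>Emptiness of \<open>S\<close>, applied to the block after \<open>i\<close>;
      \<open>L (?nx i) + k * L i\<close> is the weight on that block.\<close>
    have vertex: "(\<forall>w\<in>D. l (?nx i, w) + real k * l (i, w) = 0) \<or>
        (\<exists>w\<in>D. l (?nx i, w) + real k * l (i, w) = 1)"
      if "i < m" "L (?nx i) + real k * L i \<le> 1" for i
    proof (rule empty)
      show "0 \<le> l (?nx i, w) + real k * l (i, w)" if "w \<in> D" for w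
        using l0 that \<open>i < m\<close> cyc_suc_less[OF \<open>i < m\<close>] by simp
      show "(\<Sum>w\<in>D. l (?nx i, w) + real k * l (i, w)) \<le> 1"
        using that(2) by (simp add: L_def sum.distrib sum_distrib_left)
      show "(\<Sum>w\<in>D. (l (?nx i, w) + real k * l (i, w)) *\<^sub>R w) \<in> int_lattice d"
        using block_int_lattice[OF lat] block_sum_cyc_vertex[OF that(1) D(3)] by metis
    qed
    \<comment> \<open>Averaging: around the cycle every \<open>L i\<close> counts
      \<open>k + 1\<close> times, so the block weights sum to at most
      \<open>k + 1 < m\<close>.\<close>
    have "\<exists>i<m. L (?nx i) + real k * L i < 1"
    proof (rule ccontr)
      assume "\<not> ?thesis"
      then have "(\<Sum>i<m. 1) \<le> (\<Sum>i<m. L (?nx i) + real k * L i)"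
        by (intro sum_mono) auto
      also have "\<dots> = (real k + 1) * sum L {..<m}"
        by (simp add: sum.distrib sum_cyc_suc sum_distrib_left[symmetric] distrib_right)
      also have "\<dots> \<le> (real k + 1) * 1"
        using L1 by (intro mult_left_mono) auto
      finally show False using assms(3) by simp
    qed
    then obtain i where i: "i < m" "L (?nx i) + real k * L i < 1" by blast
    have nonneg: "0 \<le> l (?nx i, w)" "0 \<le> real k * l (i, w)" if "w \<in> D" for w
      using l0 i(1) cyc_suc_less[OF i(1)] that by auto
    \<comment> \<open>Each coefficient is below 1, which excludes the second alternative of
      \<open>vertex\<close>.\<close>
    have "l (?nx i, w) + real k * l (i, w) \<le> L (?nx i) + real k * L i" if "w \<in> D" for w
      unfolding L_def sum_distrib_left sum.distrib[symmetric]
      using nonneg that D(1) by (intro member_le_sum[of w D "\<lambda>w. l (?nx i, w) + real k * l (i, w)"]) auto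
    then have "\<forall>w\<in>D. l (?nx i, w) + real k * l (i, w) = 0"
      using vertex[of i] i by fastforce
    then have start: "\<forall>w\<in>D. l (?nx i, w) = 0"
      using nonneg by (metis add_nonneg_eq_0_iff)
    show "(\<forall>j\<in>?J. l j = 0) \<or> (\<exists>j\<in>?J. l j = 1)"
    proof (rule disjCI)
      assume no: "\<not> (\<exists>j\<in>?J. l j = 1)"
      \<comment> \<open>Once family \<open>j\<close> vanishes, the next block has weight
        \<open>L (?nx j)\<close>, at most 1, and its coefficients are those of the next family
        alone: all are 0, or one is 1, contrary to \<open>no\<close>.\<close>
      have "\<forall>w\<in>D. l (j, w) = 0" if "j < m" for j
      proof (rule cyc_suc_induct[of "?nx i" m "\<lambda>j. \<forall>w\<in>D. l (j, w) = 0"])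
        fix j assume j: "j < m" "\<forall>w\<in>D. l (j, w) = 0"
        then have "L j = 0" by (simp add: L_def)
        moreover have "L (?nx j) \<le> sum L {..<m}"
          using L0 cyc_suc_less[OF j(1)] by (intro member_le_sum) auto
        ultimately show "\<forall>w\<in>D. l (?nx j, w) = 0"
          using vertex[OF j(1)] j L1 no cyc_suc_less[OF j(1)] by fastforce
      qed (use start i cyc_suc_less that in auto)
      then show "\<forall>j\<in>?J. l j = 0" by auto
    qed
  qed
  moreover have "(real k - 1) * lattice_width d S \<le> lattice_width (d * m) ?T"
  proof (rule lattice_width_ge)
    show "1 \<le> d * m" using assms by simp
    fix f assume "f \<in> nonzero_dual_lattice (d * m)"
    then have f: "linear f" "f ` int_lattice (d * m) \<subseteq> \<int>" "\<exists>x\<in>int_lattice (d * m). f x \<noteq> 0"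
      by (auto simp: nonzero_dual_lattice_def)
    define g where "g = (\<lambda>i. f \<circ> embed d i)"
    have lin: "linear (g i)" for i
      unfolding g_def using linear_compose[OF linear_embed f(1)] .
    define F where "F = (\<lambda>i. functional_width (g i) S)"
    obtain x where x: "x \<in> int_lattice (d * m)" "f x \<noteq> 0" using f(3) by blast
    \<comment> \<open>Some component of \<open>f\<close> is nonzero on the small lattice; its width
      on \<open>S\<close> bounds the maximal one from below.\<close>
    have "f x = (\<Sum>i<m. g i (block d i x))"
      by (subst sum_embed_block[OF x(1) assms(1), symmetric])
        (simp add: linear_sum[OF f(1)] g_def)
    then obtain i0 where i0: "i0 < m" "g i0 (block d i0 x) \<noteq> 0"
      using x(2) by (metis (no_types, lifting) lessThan_iff sum.neutral)
    have "g i0 ` int_lattice d \<subseteq> \<int>"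
      using f(2) embed_int_lattice[OF _ i0(1)] by (auto simp: g_def)
    then have "g i0 \<in> nonzero_dual_lattice d"
      using lin i0(2) block_int_lattice[OF x(1)] by (auto simp: nonzero_dual_lattice_def)
    then have wF: "lattice_width d S \<le> F i0"
      unfolding F_def by (rule empty_simplex_width_le[OF assms(4)])
    have "Max (F ` {..<m}) \<in> F ` {..<m}"
      using i0 by (intro Max_in) auto
    then obtain j where j: "j < m" "Max (F ` {..<m}) = F j" by auto
    have Fj: "F i \<le> F j" if "i < m" for i
      unfolding j(2)[symmetric] using that by (intro Max_ge) auto
    obtain i where i: "i < m" "?nx i = j" using cyc_suc_surj[OF j(1)] .
    obtain p' q' where pq': "p' \<in> (+) v ` insert 0 D" "q' \<in> (+) v ` insert 0 D"
      "functional_width (g j) S \<le> g j p' - g j q'"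
      unfolding S
      by (rule functional_width_hull_attained[of "(+) v ` insert 0 D" "g j"]) (use D(1) lin in auto)
    then obtain p q where pq: "p \<in> insert 0 D" "q \<in> insert 0 D" and "p' = v + p" "q' = v + q"
      by blast
    with pq'(3) have Fjpq: "F j \<le> g j p - g j q"
      by (simp add: F_def linear_add[OF lin])
    \<comment> \<open>The points are swapped: in the worst case \<open>g i\<close> works against
      \<open>g j\<close> and costs \<open>F i\<close>, at most \<open>F j\<close>.\<close>
    have "g i q - g i p \<le> F i"
      unfolding F_def S by (rule functional_width_hull_insert_translation[OF D(1) lin pq(2,1)])
    \<comment> \<open>At \<open>u = 0\<close> the formula yields the vertex 0 of \<open>?T\<close>,
      so \<open>p\<close> or \<open>q\<close> may be 0.\<close>
    have vT: "?e (i, u) \<in> ?T" if "u \<in> insert 0 D" for u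
      using that i(1) by (auto simp: cyc_vertex_def linear_0[OF linear_embed] intro: hull_inc)
    have "f (?e (i, p)) - f (?e (i, q)) \<le> functional_width f ?T"
      using functional_width_hull_ge[OF _ f(1) vT[OF pq(1)] vT[OF pq(2)]] finJ by simp
    then have "(g i p - g i q) + real k * (g j p - g j q) \<le> functional_width f ?T"
      by (simp add: cyc_vertex_def g_def i(2) linear_add[OF f(1)] linear_cmul[OF f(1)] algebra_simps)
    moreover have "real k * F j \<le> real k * (g j p - g j q)"
      using Fjpq by (intro mult_left_mono) auto
    ultimately have "(real k - 1) * F j \<le> functional_width f ?T"
      using \<open>g i q - g i p \<le> F i\<close> Fj[OF i(1)] by (simp add: left_diff_distrib)
    moreover have "(real k - 1) * lattice_width d S \<le> (real k - 1) * F j"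
      using wF Fj[OF i0(1)] assms(2) by (intro mult_left_mono) auto
    ultimately show "(real k - 1) * lattice_width d S \<le> functional_width f ?T"
      by linarith
  qed
  ultimately show thesis using that by blast
qed

section \<open>The inequality and the limit superior\<close>

lemma w_e_nonneg:
  assumes "d \<ge> 1"
  shows "0 \<le> w_e d"
  using order_trans[OF _ w_e_ge_1[OF assms], of 0] by simp

lemma w_e_mult_ge:
  assumes "d \<ge> 1" "m \<ge> 1"
  shows "ereal (real m - 3) * w_e d \<le> w_e (d * m)"
proof (cases "m \<ge> 4")
  case False
  \<comment> \<open>For \<open>m\<close> at most 3 the factor is not positive.\<close>
  then have "ereal (real m - 3) * w_e d \<le> 0"
    using w_e_nonneg[OF assms(1)] by (simp add: ereal_mult_le_0_iff)
  also have "0 \<le> w_e (d * m)"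
    using w_e_nonneg[of "d * m"] assms by simp
  finally show ?thesis .
next
  case True
  \<comment> \<open>This allows the factor to move inside the supremum.\<close>
  have "{S. empty_simplex d S} \<noteq> {}"
  proof
    assume "{S. empty_simplex d S} = {}"
    then have "w_e d = - \<infinity>"
      unfolding w_e_def by (simp only: image_empty Sup_empty bot_ereal_def)
    then show False
      using w_e_nonneg[OF assms(1)] by simp
  qed
  then have "ereal (real m - 3) * w_e d =
      (SUP S\<in>{S. empty_simplex d S}. ereal (real m - 3) * ereal (lattice_width d S))"
    unfolding w_e_def using True by (intro Sup_ereal_mult_left') auto
  also have "\<dots> \<le> w_e (d * m)"
  proof (rule SUP_least)
    fix S assume "S \<in> {S. empty_simplex d S}"
    then have S: "empty_simplex d S" by simp
    \<comment> \<open>\<open>k = m - 2\<close> is the largest value with \<open>k + 1 < m\<close>,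
      and \<open>k - 1 = m - 3\<close>.\<close>
    have m: "2 \<le> m - 2" "m - 2 + 1 < m" using True by auto
    obtain T where "empty_simplex (d * m) T"
      "(real (m - 2) - 1) * lattice_width d S \<le> lattice_width (d * m) T"
      using ex_large_simplex[OF assms(1) m S] .
    then show "ereal (real m - 3) * ereal (lattice_width d S) \<le> w_e (d * m)"
      unfolding w_e_def using True by (intro SUP_upper2[of T]) (auto simp: of_nat_diff)
  qed
  finally show ?thesis .
qed

lemma limsup_w_e_ge:
  assumes "d \<ge> 1"
  shows "w_e d / ereal (real d) \<le> limsup (\<lambda>d. w_e d / ereal (real d))"
proof -
  let ?X = "\<lambda>d. w_e d / ereal (real d)"
  have mono: "strict_mono ((*) d)"
    using assms by (auto simp: strict_mono_def)
  have "ereal (1 - 3 / real m) * ?X d \<le> (?X \<circ> (*) d) m" if "m \<ge> 1" for m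
  proof -
    have "ereal (1 - 3 / real m) * ?X d = (ereal (real m - 3) * w_e d) / ereal (real (d * m))"
      \<comment> \<open>The cases include infinite values of \<open>w_e d\<close>.\<close>
      using that assms by (cases "w_e d") (auto simp: field_simps)
    also have "\<dots> \<le> w_e (d * m) / ereal (real (d * m))"
      using w_e_mult_ge[OF assms that] assms that by (intro ereal_divide_right_mono) auto
    finally show ?thesis by simp
  qed
  then have ev: "\<forall>\<^sub>F m in sequentially. ereal (1 - 3 / real m) * ?X d \<le> (?X \<circ> (*) d) m"
    by (auto intro: eventually_sequentiallyI[of 1])
  have "(\<lambda>m. 1 - 3 / real m) \<longlonglongrightarrow> 1"
    using tendsto_diff[OF tendsto_const lim_const_over_n[of 3], of 1] by simp
  then have "(\<lambda>m. ereal (1 - 3 / real m)) \<longlonglongrightarrow> ereal 1"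
    by simp
  \<comment> \<open>The limit 1 is finite and nonzero, so the product converges even if
    \<open>?X d\<close> is infinite.\<close>
  then have "(\<lambda>m. ereal (1 - 3 / real m) * ?X d) \<longlonglongrightarrow> ereal 1 * ?X d"
    by (intro tendsto_mult_ereal) auto
  then have "?X d = limsup (\<lambda>m. ereal (1 - 3 / real m) * ?X d)"
    by (metis lim_imp_Limsup mult.left_neutral one_ereal_def sequentially_bot)
  also have "\<dots> \<le> limsup (?X \<circ> (*) d)"
    by (rule Limsup_mono[OF ev])
  also have "\<dots> \<le> limsup ?X"
    by (rule limsup_subseq_mono[OF mono])
  finally show ?thesis .
qed

theorem theorem1p8:
  shows "(\<forall>d m :: nat. d \<ge> 1 \<longrightarrow> m \<ge> 1 \<longrightarrow> w_e (d * m) \<ge> ereal (real m - 3) * w_e d)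
    \<and> limsup (\<lambda>d. w_e d / ereal (real d)) = (SUP d\<in>{1..}. w_e d / ereal (real d))
    \<and> (SUP d\<in>{1..}. w_e d / ereal (real d)) \<ge> 1"
proof (intro conjI allI impI)
  let ?X = "\<lambda>d. w_e d / ereal (real d)"
  show "ereal (real m - 3) * w_e d \<le> w_e (d * m)" if "d \<ge> 1" "m \<ge> 1" for d m
    using that by (rule w_e_mult_ge)
  show "limsup ?X = (SUP d\<in>{1..}. ?X d)"
  proof (rule antisym)
    show "limsup ?X \<le> (SUP d\<in>{1..}. ?X d)"
      \<comment> \<open>Index 0 lies outside the supremum but does not affect the limit
        superior.\<close>
      by (rule Limsup_bounded) (auto intro!: eventually_sequentiallyI[of 1] SUP_upper)
    show "(SUP d\<in>{1..}. ?X d) \<le> limsup ?X"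
      by (rule SUP_least) (auto intro: limsup_w_e_ge)
  qed
  have "1 \<le> ?X 1"
    using w_e_ge_1[of 1] by (simp flip: one_ereal_def)
  then show "1 \<le> (SUP d\<in>{1..}. ?X d)"
    by (rule SUP_upper2[rotated]) simp
qed

end
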